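(* Let $\mathcal L_0$ be the generator of an ergodic time-reversible Markov process with invariant probability measure $\pi$ on a Polish space $E$, let $\mathcal S$ be a reversible perturbation and $\mathcal A$ an irreversible perturbation (as defined in the context), and let $\mathcal L=\mathcal L_0+\mathcal S+\mathcal A$. Let $I$ and $I_o$ be the Donsker–Varadhan large deviation rate functions of the empirical measure of the processes with generators $\mathcal L$ and $\mathcal L_0$ respectively. Then for every probability measure $\mu\in\mathcal P(E)$, absolutely continuous with respect to $\pi$, such that $(d\mu/d\pi)^{1/2}\in D(\mathcal L_0)$, one has $$I(\mu)\ge I_o(\mu).$$
   Context: $\mathcal P(E)$ is the space of probability measures on the Polish space $E$ with the weak topology. $L^2_{\mathbb R}(\pi)$ has scalar product $\langle f,g\rangle=\int fg\,d\pi$. Reference process: the Markov process with generator $\mathcal L_0$ (domain $D(\mathcal L_0)\subset L^2_{\mathbb R}(\pi)$) is ergodic and reversible with invariant measure $\pi$, so $\mathcal L_0$ is self-adjoint; it has a spectral gap: there is $\lambda_0<0$ with $\sigma(\mathcal L_0)\setminus\{0\}\subset(-\infty,\lambda_0]$; in particular $\langle f,\mathcal L_0f\rangle\le0$. Reversible perturbation $\mathcal S$: $D(\mathcal L_0)\subset D(\mathcal S)$; $\mathcal L_0+\mathcal S$ is the (self-adjoint) generator of a Markov process with invariant measure $\pi$; $\mathcal S$ is self-adjoint; $\langle f,\mathcal S f\rangle\le0$ for all $f\in D(\mathcal S)$. Irreversible perturbation $\mathcal A$: $D(\mathcal L_0+\mathcal S)\subset D(\mathcal A)$; $\mathcal L=\mathcal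 L_0+\mathcal S+\mathcal A$ is the generator of a Markov process with invariant measure $\pi$; $\langle f,\mathcal A g\rangle=-\langle\mathcal A f,g\rangle$ for $f,g\in D(\mathcal A)$. Standing assumptions on large deviations: for each process involved the empirical measures $\mu_t=\frac1t\int_0^t\delta_{X(s)}\,ds$ satisfy a large deviation principle in $\mathcal P(E)$ as $t\to\infty$ (speed $t$) with rate function given by the Donsker–Varadhan formula $$I(\mu)=-\inf_{u>0,\ u\in D(\mathcal L)}\int\frac{\mathcal L u}{u}\,d\mu ,$$ and when the generator is reversible (self-adjoint), such as $\mathcal L_0$ or $\mathcal L_0+\mathcal S$, the rate function is given by $$I_o(\mu)=\Big\langle\Big(\tfrac{d\mu}{d\pi}\Big)^{1/2},(-\mathcal L_0)\Big(\tfrac{d\mu}{d\pi}\Big)^{1/2}\Big\rangle$$ (with $\mathcal L_0$ replaced by the reversible generator in question). *)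

theory Defs
  imports "HOL-Probability.Probability"
begin

text \<open>Elements of \<open>L\<^sup>2(\<pi>)\<close> are represented by functions, and operators are required to respect
  equality \<open>\<pi>\<close>-almost everywhere (see \<open>linear_operator\<close>).\<close>

definition L2 :: "'a measure \<Rightarrow> ('a \<Rightarrow> real) set" where
  "L2 \<pi> = {f \<in> borel_measurable \<pi>. integrable \<pi> (\<lambda>x. (f x)\<^sup>2)}"

definition L2_inner :: "'a measure \<Rightarrow> ('a \<Rightarrow> real) \<Rightarrow> ('a \<Rightarrow> real) \<Rightarrow> real" where
  "L2_inner \<pi> f g = (\<integral>x. f x * g x \<partial>\<pi>)"

definition L2_norm :: "'a measure \<Rightarrow> ('a \<Rightarrow> real) \<Rightarrow> real" where
  "L2_norm \<pi> f = sqrt (L2_inner \<pi> f f)"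

record 'a operator =
  op_dom :: "('a \<Rightarrow> real) set"
  op_app :: "('a \<Rightarrow> real) \<Rightarrow> ('a \<Rightarrow> real)"

definition linear_operator :: "'a measure \<Rightarrow> 'a operator \<Rightarrow> bool" where
  "linear_operator \<pi> L \<longleftrightarrow>
     op_dom L \<subseteq> L2 \<pi> \<and> (\<forall>f\<in>op_dom L. op_app L f \<in> L2 \<pi>) \<and>
     (\<lambda>x. 0) \<in> op_dom L \<and>
     (\<forall>f\<in>op_dom L. \<forall>g\<in>op_dom L. (\<lambda>x. f x + g x) \<in> op_dom L \<and>
        (AE x in \<pi>. op_app L (\<lambda>x. f x + g x) x = op_app L f x + op_app L g x)) \<and>
     (\<forall>c. \<forall>f\<in>op_dom L. (\<lambda>x. c * f x) \<in> op_dom L \<and>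
        (AE x in \<pi>. op_app L (\<lambda>x. c * f x) x = c * op_app L f x)) \<and>
     (\<forall>f\<in>op_dom L. \<forall>g\<in>L2 \<pi>. (AE x in \<pi>. f x = g x) \<longrightarrow>
        g \<in> op_dom L \<and> (AE x in \<pi>. op_app L f x = op_app L g x))"

definition op_add :: "'a operator \<Rightarrow> 'a operator \<Rightarrow> 'a operator" where
  "op_add K L = \<lparr>op_dom = op_dom K \<inter> op_dom L, op_app = (\<lambda>f x. op_app K f x + op_app L f x)\<rparr>"

definition densely_defined :: "'a measure \<Rightarrow> 'a operator \<Rightarrow> bool" where
  "densely_defined \<pi> L \<longleftrightarrow>
     (\<forall>f\<in>L2 \<pi>. \<forall>\<epsilon>>0. \<exists>g\<in>op_dom L. L2_norm \<pi> (\<lambda>x. f x - g x) < \<epsilon>)"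

definition adjoint_dom :: "'a measure \<Rightarrow> 'a operator \<Rightarrow> ('a \<Rightarrow> real) set" where
  "adjoint_dom \<pi> L =
     {g \<in> L2 \<pi>. \<exists>h\<in>L2 \<pi>. \<forall>f\<in>op_dom L. L2_inner \<pi> (op_app L f) g = L2_inner \<pi> f h}"

definition self_adjoint :: "'a measure \<Rightarrow> 'a operator \<Rightarrow> bool" where
  "self_adjoint \<pi> L \<longleftrightarrow> densely_defined \<pi> L \<and>
     (\<forall>f\<in>op_dom L. \<forall>g\<in>op_dom L. L2_inner \<pi> (op_app L f) g = L2_inner \<pi> f (op_app L g)) \<and>
     adjoint_dom \<pi> L = op_dom L"

text \<open>The norm bound contains injectivity of \<open>L - z\<close> as well as boundedness of its inverse. Only
  real \<open>z\<close> are considered, which is no loss for self-adjoint operators.\<close>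

definition spectrum :: "'a measure \<Rightarrow> 'a operator \<Rightarrow> real set" where
  "spectrum \<pi> L = {z. \<not> (
     (\<exists>C. \<forall>f\<in>op_dom L. L2_norm \<pi> f \<le> C * L2_norm \<pi> (\<lambda>x. op_app L f x - z * f x)) \<and>
     (\<forall>g\<in>L2 \<pi>. \<exists>f\<in>op_dom L. AE x in \<pi>. op_app L f x - z * f x = g x))}"

definition markov_semigroup :: "(real \<Rightarrow> 'a::polish_space \<Rightarrow> 'a measure) \<Rightarrow> bool" where
  "markov_semigroup P \<longleftrightarrow>
     (\<forall>t\<ge>0. P t \<in> borel \<rightarrow>\<^sub>M prob_algebra borel) \<and>
     (\<forall>x. P 0 x = return borel x) \<and>
     (\<forall>s\<ge>0. \<forall>t\<ge>0. \<forall>x. P (s + t) x = P s x \<bind> P t)"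

definition invariant :: "'a measure \<Rightarrow> (real \<Rightarrow> 'a \<Rightarrow> 'a measure) \<Rightarrow> bool" where
  "invariant \<pi> P \<longleftrightarrow> (\<forall>t\<ge>0. \<pi> \<bind> P t = \<pi>)"

definition semigroup_app :: "(real \<Rightarrow> 'a \<Rightarrow> 'a measure) \<Rightarrow> real \<Rightarrow> ('a \<Rightarrow> real) \<Rightarrow> 'a \<Rightarrow> real" where
  "semigroup_app P t f x = (\<integral>y. f y \<partial>P t x)"

definition strongly_continuous :: "'a measure \<Rightarrow> (real \<Rightarrow> 'a \<Rightarrow> 'a measure) \<Rightarrow> bool" where
  "strongly_continuous \<pi> P \<longleftrightarrow>
     (\<forall>f\<in>L2 \<pi>. ((\<lambda>t. L2_norm \<pi> (\<lambda>x. semigroup_app P t f x - f x)) \<longlongrightarrow> 0) (at_right 0))"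

definition reversible :: "'a measure \<Rightarrow> (real \<Rightarrow> 'a \<Rightarrow> 'a measure) \<Rightarrow> bool" where
  "reversible \<pi> P \<longleftrightarrow> (\<forall>t\<ge>0. \<forall>B\<in>sets \<pi>. \<forall>C\<in>sets \<pi>.
     (\<integral>\<^sup>+x\<in>B. emeasure (P t x) C \<partial>\<pi>) = (\<integral>\<^sup>+x\<in>C. emeasure (P t x) B \<partial>\<pi>))"

definition ergodic :: "'a measure \<Rightarrow> (real \<Rightarrow> 'a \<Rightarrow> 'a measure) \<Rightarrow> bool" where
  "ergodic \<pi> P \<longleftrightarrow> (\<forall>B\<in>sets \<pi>.
     (\<forall>t\<ge>0. AE x in \<pi>. measure (P t x) B = indicator B x) \<longrightarrow> measure \<pi> B = 0 \<or> measure \<pi> B = 1)"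

definition generator_limit ::
    "'a measure \<Rightarrow> (real \<Rightarrow> 'a \<Rightarrow> 'a measure) \<Rightarrow> ('a \<Rightarrow> real) \<Rightarrow> ('a \<Rightarrow> real) \<Rightarrow> bool" where
  "generator_limit \<pi> P f g \<longleftrightarrow>
     ((\<lambda>t. L2_norm \<pi> (\<lambda>x. (semigroup_app P t f x - f x) / t - g x)) \<longlongrightarrow> 0) (at_right 0)"

definition markov_generator ::
    "'a::polish_space measure \<Rightarrow> (real \<Rightarrow> 'a \<Rightarrow> 'a measure) \<Rightarrow> 'a operator \<Rightarrow> bool" where
  "markov_generator \<pi> P L \<longleftrightarrow>
     markov_semigroup P \<and> invariant \<pi> P \<and> strongly_continuous \<pi> P \<and>
     linear_operator \<pi> L \<and>
     op_dom L = {f \<in> L2 \<pi>. \<exists>g\<in>L2 \<pi>. generator_limit \<pi> P f g} \<and>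
     (\<forall>f\<in>op_dom L. generator_limit \<pi> P f (op_app L f))"

definition reference_process ::
    "'a::polish_space measure \<Rightarrow> (real \<Rightarrow> 'a \<Rightarrow> 'a measure) \<Rightarrow> 'a operator \<Rightarrow> bool" where
  "reference_process \<pi> P\<^sub>0 L\<^sub>0 \<longleftrightarrow>
     markov_generator \<pi> P\<^sub>0 L\<^sub>0 \<and> ergodic \<pi> P\<^sub>0 \<and> reversible \<pi> P\<^sub>0 \<and>
     (\<exists>z\<^sub>0<0. spectrum \<pi> L\<^sub>0 - {0} \<subseteq> {..z\<^sub>0})"

definition reversible_perturbation ::
    "'a::polish_space measure \<Rightarrow> 'a operator \<Rightarrow> (real \<Rightarrow> 'a \<Rightarrow> 'a measure) \<Rightarrow> 'a operator \<Rightarrow> bool" where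
  "reversible_perturbation \<pi> L\<^sub>0 P\<^sub>S S \<longleftrightarrow>
     linear_operator \<pi> S \<and> op_dom L\<^sub>0 \<subseteq> op_dom S \<and>
     markov_generator \<pi> P\<^sub>S (op_add L\<^sub>0 S) \<and> self_adjoint \<pi> (op_add L\<^sub>0 S) \<and>
     self_adjoint \<pi> S \<and> (\<forall>f\<in>op_dom S. L2_inner \<pi> f (op_app S f) \<le> 0)"

definition irreversible_perturbation ::
    "'a::polish_space measure \<Rightarrow> 'a operator \<Rightarrow> 'a operator \<Rightarrow> (real \<Rightarrow> 'a \<Rightarrow> 'a measure) \<Rightarrow>
     'a operator \<Rightarrow> bool" where
  "irreversible_perturbation \<pi> L\<^sub>0 S P A \<longleftrightarrow>
     linear_operator \<pi> A \<and> op_dom (op_add L\<^sub>0 S) \<subseteq> op_dom A \<and>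
     markov_generator \<pi> P (op_add (op_add L\<^sub>0 S) A) \<and>
     (\<forall>f\<in>op_dom A. \<forall>g\<in>op_dom A. L2_inner \<pi> f (op_app A g) = - L2_inner \<pi> (op_app A f) g)"

definition natural_filtration ::
    "'w measure \<Rightarrow> (real \<Rightarrow> 'w \<Rightarrow> 'a::topological_space) \<Rightarrow> real \<Rightarrow> 'w measure" where
  "natural_filtration M X s =
     sigma (space M) (\<Union>r\<in>{0..s}. {X r -` B \<inter> space M | B. B \<in> sets borel})"

text \<open>The initial law is arbitrary, and \<open>X t\<close> is irrelevant for \<open>t < 0\<close>.\<close>

definition markov_process ::
    "'w measure \<Rightarrow> (real \<Rightarrow> 'w \<Rightarrow> 'a::polish_space) \<Rightarrow> (real \<Rightarrow> 'a \<Rightarrow> 'a measure) \<Rightarrow> bool" where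
  "markov_process M X P \<longleftrightarrow>
     prob_space M \<and>
     (\<lambda>(t, w). X t w) \<in> restrict_space borel {0..} \<Otimes>\<^sub>M M \<rightarrow>\<^sub>M borel \<and>
     (\<forall>s\<ge>0. \<forall>t\<ge>s. \<forall>B\<in>sets borel.
        AE w in M. real_cond_exp M (natural_filtration M X s) (\<lambda>w. indicator B (X t w)) w
          = measure (P (t - s) (X s w)) B)"

definition empirical_measure ::
    "(real \<Rightarrow> 'w \<Rightarrow> 'a::topological_space) \<Rightarrow> real \<Rightarrow> 'w \<Rightarrow> 'a measure" where
  "empirical_measure X t w = measure_of UNIV (sets borel)
     (\<lambda>B. (\<integral>\<^sup>+s\<in>{0..t}. emeasure (return borel (X s w)) B \<partial>lborel) / ennreal t)"

definition weak_topology :: "'a::topological_space measure topology" where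
  "weak_topology = topology_generated_by
     {{\<mu> \<in> space (prob_algebra borel). (\<integral>x. f x \<partial>\<mu>) \<in> U} | (f :: 'a \<Rightarrow> real) U.
       continuous_on UNIV f \<and> bounded (range f) \<and> open U}"

definition log_prob :: "real \<Rightarrow> ereal" where
  "log_prob p = (if p = 0 then -\<infinity> else ereal (ln p))"

definition rate_function :: "('a::topological_space measure \<Rightarrow> ereal) \<Rightarrow> bool" where
  "rate_function I \<longleftrightarrow> (\<forall>\<mu>\<in>topspace weak_topology. 0 \<le> I \<mu>) \<and>
     (\<forall>c. closedin weak_topology {\<mu> \<in> topspace weak_topology. I \<mu> \<le> c})"

definition empirical_LDP ::
    "'w measure \<Rightarrow> (real \<Rightarrow> 'w \<Rightarrow> 'a::topological_space) \<Rightarrow> ('a measure \<Rightarrow> ereal) \<Rightarrow> bool" where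
  "empirical_LDP M X I \<longleftrightarrow> rate_function I \<and>
     (\<forall>G. openin weak_topology G \<longrightarrow>
        - (INF \<mu>\<in>G. I \<mu>) \<le> Liminf at_top (\<lambda>t.
            ereal (1 / t) * log_prob (measure M {w \<in> space M. empirical_measure X t w \<in> G}))) \<and>
     (\<forall>F. closedin weak_topology F \<longrightarrow>
        Limsup at_top (\<lambda>t.
            ereal (1 / t) * log_prob (measure M {w \<in> space M. empirical_measure X t w \<in> F}))
          \<le> - (INF \<mu>\<in>F. I \<mu>))"

text \<open>The integral with values in the extended reals. When positive and negative part both have
  infinite integral the value is \<open>\<infinity> - \<infinity> = \<infinity>\<close>, so such integrands do not contribute to
  the infimum below.\<close>

definition ext_integral :: "'a measure \<Rightarrow> ('a \<Rightarrow> real) \<Rightarrow> ereal" where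
  "ext_integral \<mu> f =
     enn2ereal (\<integral>\<^sup>+x. ennreal (f x) \<partial>\<mu>) - enn2ereal (\<integral>\<^sup>+x. ennreal (- f x) \<partial>\<mu>)"

definition donsker_varadhan :: "'a measure \<Rightarrow> 'a operator \<Rightarrow> 'a measure \<Rightarrow> ereal" where
  "donsker_varadhan \<pi> L \<mu> =
     - (INF u\<in>{u \<in> op_dom L. AE x in \<pi>. 0 < u x}. ext_integral \<mu> (\<lambda>x. op_app L u x / u x))"

definition sqrt_density :: "'a measure \<Rightarrow> 'a measure \<Rightarrow> 'a \<Rightarrow> real" where
  "sqrt_density \<pi> \<mu> x = sqrt (enn2real (RN_deriv \<pi> \<mu> x))"

text \<open>Elements of \<open>L\<^sup>2(\<pi>)\<close> are only determined up to \<open>\<pi>\<close>-null sets, so the formulas are imposed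
  on measures which are absolutely continuous with respect to \<open>\<pi>\<close>, and the reversible one where
  \<open>(d\<mu>/d\<pi>)\<^sup>1\<^sup>/\<^sup>2\<close> lies in the domain of the generator.\<close>

definition DV_rate_function ::
    "'a::polish_space measure \<Rightarrow> 'a operator \<Rightarrow> ('a measure \<Rightarrow> ereal) \<Rightarrow> bool" where
  "DV_rate_function \<pi> L I \<longleftrightarrow>
     (\<forall>\<mu>\<in>space (prob_algebra borel). absolutely_continuous \<pi> \<mu> \<longrightarrow> I \<mu> = donsker_varadhan \<pi> L \<mu>)"

definition reversible_rate_function ::
    "'a::polish_space measure \<Rightarrow> 'a operator \<Rightarrow> ('a measure \<Rightarrow> ereal) \<Rightarrow> bool" where
  "reversible_rate_function \<pi> L I \<longleftrightarrow>
     (\<forall>\<mu>\<in>space (prob_algebra borel).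
        absolutely_continuous \<pi> \<mu> \<and> sqrt_density \<pi> \<mu> \<in> op_dom L \<longrightarrow>
        I \<mu> = ereal (L2_inner \<pi> (sqrt_density \<pi> \<mu>) (\<lambda>x. - op_app L (sqrt_density \<pi> \<mu>) x)))"

end

theory Submission
  imports Defs
begin

text \<open>Write \<open>f = (d\<mu>/d\<pi>)\<^sup>1\<^sup>/\<^sup>2\<close>. Inserting \<open>u = f + \<epsilon>\<close> into the Donsker--Varadhan formula is legitimate
  since constants lie in the domain and \<open>\<L> 1 = 0\<close>; the shift makes \<open>u\<close> positive where \<open>f\<close> vanishes.
  Dominated convergence with majorant \<open>\<bar>f \<L>f\<bar>\<close> as \<open>\<epsilon> \<rightarrow> 0\<close> gives \<open>I(\<mu>) \<ge> - \<langle>f, \<L>f\<rangle>\<close>. There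
  \<open>\<langle>f, \<A>f\<rangle> = 0\<close> by antisymmetry and \<open>\<langle>f, \<S>f\<rangle> \<le> 0\<close>, which leaves \<open>- \<langle>f, \<L>\<^sub>0f\<rangle> = I\<^sub>o(\<mu>)\<close>.\<close>

lemma L2_measurable: "f \<in> L2 \<pi> \<Longrightarrow> f \<in> borel_measurable \<pi>"
  by (simp add: L2_def)

text \<open>The majorant is \<open>f\<^sup>2 + g\<^sup>2\<close>. Integrability is what permits
  splitting \<open>L2_inner\<close> over a sum, since the Bochner integral of a non-integrable
  function is 0 by convention.\<close>

lemma L2_integrable_mult:
  assumes "f \<in> L2 \<pi>" "g \<in> L2 \<pi>"
  shows "integrable \<pi> (\<lambda>x. f x * g x)"
proof (rule Bochner_Integration.integrable_bound)
  show "integrable \<pi> (\<lambda>x. (f x)\<^sup>2 + (g x)\<^sup>2)"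
    using assms by (auto simp: L2_def)
  show "(\<lambda>x. f x * g x) \<in> borel_measurable \<pi>"
    using assms by (auto simp: L2_def)
  have "\<bar>a * b\<bar> \<le> a\<^sup>2 + b\<^sup>2" for a b :: real
  proof -
    have "2 * (\<bar>a\<bar> * \<bar>b\<bar>) \<le> a\<^sup>2 + b\<^sup>2"
      using sum_squares_bound[of "\<bar>a\<bar>" "\<bar>b\<bar>"] by simp
    moreover have "0 \<le> \<bar>a\<bar> * \<bar>b\<bar>" by simp
    ultimately show ?thesis unfolding abs_mult by linarith
  qed
  then show "AE x in \<pi>. norm (f x * g x) \<le> norm ((f x)\<^sup>2 + (g x)\<^sup>2)"
    by simp
qed

text \<open>On functions, as opposed to classes, \<open>L2_norm\<close> is only a seminorm, so a
  vanishing limit fixes a function up to null sets at best.\<close>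

lemma L2_norm_eq_0_imp_AE:
  assumes "g \<in> L2 \<pi>" "L2_norm \<pi> g = 0"
  shows "AE x in \<pi>. g x = 0"
proof -
  have int: "integrable \<pi> (\<lambda>x. g x * g x)"
    using L2_integrable_mult assms(1) by blast
  have "(\<integral>x. g x * g x \<partial>\<pi>) = 0"
    using assms(2) by (simp add: L2_norm_def L2_inner_def)
  then have "AE x in \<pi>. g x * g x = 0"
    using integral_nonneg_eq_0_iff_AE[OF int] by simp
  then show ?thesis by simp
qed

lemma semigroup_app_1:
  assumes "markov_semigroup P" "0 \<le> t"
  shows "semigroup_app P t (\<lambda>x. 1) x = 1"
proof -
  have "P t x \<in> space (prob_algebra borel)"
    using assms measurable_space[of "P t" borel "prob_algebra borel" x]
    by (auto simp: markov_semigroup_def)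
  then interpret prob_space "P t x"
    by (simp add: space_prob_algebra)
  show ?thesis
    by (simp add: semigroup_app_def prob_space)
qed

text \<open>The kernels have mass 1, so every difference quotient of the constant 1 vanishes. Hence
  0 is a generator limit, and any other limit has norm 0. The constant lies in
  \<open>L2 \<pi>\<close> because \<pi> is finite.\<close>

lemma markov_generator_1:
  assumes gen: "markov_generator \<pi> P L" and prob: "prob_space \<pi>"
  shows "(\<lambda>x. 1) \<in> op_dom L" "AE x in \<pi>. op_app L (\<lambda>x. 1) x = 0"
proof -
  interpret prob_space \<pi> by (rule prob)
  have ms: "markov_semigroup P"
    using gen by (simp add: markov_generator_def)
  \<comment> \<open>The quotient is 0 for all t > 0, so the norm does not depend on t; the endpoint
    1 of the interval is arbitrary.\<close>
  have diff: "\<forall>\<^sub>F t in at_right 0.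
      L2_norm \<pi> (\<lambda>x. (semigroup_app P t (\<lambda>x. 1) x - 1) / t - g x) = L2_norm \<pi> g" for g
    unfolding eventually_at_right_field
    by (intro exI[of _ 1]) (auto simp: semigroup_app_1[OF ms] L2_norm_def L2_inner_def)
  have limit_iff: "generator_limit \<pi> P (\<lambda>x. 1) g \<longleftrightarrow> L2_norm \<pi> g = 0" for g
    unfolding generator_limit_def tendsto_cong[OF diff]
    by (simp add: tendsto_const_iff)
  have "generator_limit \<pi> P (\<lambda>x. 1) (\<lambda>x. 0)"
    unfolding limit_iff by (simp add: L2_norm_def L2_inner_def)
  then show one: "(\<lambda>x. 1) \<in> op_dom L"
    using gen by (auto simp: markov_generator_def L2_def intro!: bexI[of _ "\<lambda>x. 0"])
  show "AE x in \<pi>. op_app L (\<lambda>x. 1) x = 0"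
  proof (rule L2_norm_eq_0_imp_AE)
    show "op_app L (\<lambda>x. 1) \<in> L2 \<pi>"
      using gen one by (simp add: markov_generator_def linear_operator_def)
    show "L2_norm \<pi> (op_app L (\<lambda>x. 1)) = 0"
      using gen one limit_iff unfolding markov_generator_def by blast
  qed
qed

lemma markov_generator_add_const:
  assumes gen: "markov_generator \<pi> P L" and prob: "prob_space \<pi>" and f: "f \<in> op_dom L"
  shows "(\<lambda>x. f x + c) \<in> op_dom L" "AE x in \<pi>. op_app L (\<lambda>x. f x + c) x = op_app L f x"
proof -
  note one = markov_generator_1[OF gen prob]
  have lin: "linear_operator \<pi> L"
    using gen by (simp add: markov_generator_def)
  \<comment> \<open>The form \<open>c * 1\<close> is kept unsimplified so that it matches the
    scaling clause of \<open>linear_operator\<close>, applied to the constant 1.\<close>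
  have c: "(\<lambda>x. c * 1) \<in> op_dom L" "AE x in \<pi>. op_app L (\<lambda>x. c * 1) x = c * op_app L (\<lambda>x. 1) x"
    using lin one(1) by (simp_all add: linear_operator_def del: mult_1_right)
  have s: "(\<lambda>x. f x + c * 1) \<in> op_dom L"
    "AE x in \<pi>. op_app L (\<lambda>x. f x + c * 1) x = op_app L f x + op_app L (\<lambda>x. c * 1) x"
    using lin c(1) f by (simp_all add: linear_operator_def del: mult_1_right)
  show "(\<lambda>x. f x + c) \<in> op_dom L"
    using s(1) by simp
  show "AE x in \<pi>. op_app L (\<lambda>x. f x + c) x = op_app L f x"
    using s(2) c(2) one(2) by eventually_elim simp
qed

text \<open>Both parts have finite integral, so the convention for \<infinity> - \<infinity> does
  not enter.\<close>

lemma ext_integral_eq_integral: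
  assumes "integrable M h"
  shows "ext_integral M h = ereal (\<integral>x. h x \<partial>M)"
proof -
  obtain r q where rq: "0 \<le> r" "0 \<le> q"
      "(\<integral>\<^sup>+x. ennreal (h x) \<partial>M) = ennreal r" "(\<integral>\<^sup>+x. ennreal (- h x) \<partial>M) = ennreal q"
      "(\<integral>x. h x \<partial>M) = r - q"
    using integrableE[OF assms] by metis
  then show ?thesis
    by (simp add: ext_integral_def enn2ereal_ennreal)
qed

text \<open>The function \<open>op_app L u\<close> is known only up to \<pi>-null sets, so the
  integrand \<open>k\<close> is exchanged for an explicit representative \<open>h\<close>. Absolute
  continuity makes the exchange valid under \<mu>, and the squared density is the Radon-Nikodym
  derivative.\<close>

lemma ext_integral_density:
  assumes prob: "prob_space \<pi>" "prob_space \<mu>"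
    and sets: "sets \<mu> = sets \<pi>" and ac: "absolutely_continuous \<pi> \<mu>"
    and [measurable]: "h \<in> borel_measurable \<pi>"
    and int: "integrable \<pi> (\<lambda>x. (sqrt_density \<pi> \<mu> x)\<^sup>2 * h x)"
    and eq: "AE x in \<pi>. k x = h x"
  shows "ext_integral \<mu> k = ereal (\<integral>x. (sqrt_density \<pi> \<mu> x)\<^sup>2 * h x \<partial>\<pi>)"
proof -
  interpret \<pi>: prob_space \<pi> by (rule prob)
  interpret \<mu>: prob_space \<mu> by (rule prob)
  have sq: "(sqrt_density \<pi> \<mu> x)\<^sup>2 = enn2real (RN_deriv \<pi> \<mu> x)" for x
    by (simp add: sqrt_density_def)
  have "AE x in \<mu>. k x = h x"
    using absolutely_continuous_AE[OF sets ac eq] .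
  then have "ext_integral \<mu> k = ext_integral \<mu> h"
    unfolding ext_integral_def
    by (intro arg_cong2[where f = "(-)"] arg_cong[where f = enn2ereal] nn_integral_cong_AE)
       (auto elim: eventually_mono)
  also have "\<dots> = ereal (\<integral>x. h x \<partial>\<mu>)"
    using int \<pi>.RN_deriv_integrable[OF \<mu>.sigma_finite_measure_axioms ac sets, of h]
    by (intro ext_integral_eq_integral) (simp add: sq)
  also have "(\<integral>x. h x \<partial>\<mu>) = (\<integral>x. (sqrt_density \<pi> \<mu> x)\<^sup>2 * h x \<partial>\<pi>)"
    using \<pi>.RN_deriv_integral[OF \<mu>.sigma_finite_measure_axioms ac sets, of h]
    by (simp add: sq)
  finally show ?thesis .
qed

lemma donsker_varadhan_ge:
  assumes gen: "markov_generator \<pi> P L"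
    and prob: "prob_space \<pi>" "prob_space \<mu>"
    and sets: "sets \<mu> = sets \<pi>" and ac: "absolutely_continuous \<pi> \<mu>"
    and f: "sqrt_density \<pi> \<mu> \<in> op_dom L"
  shows "ereal (- L2_inner \<pi> (sqrt_density \<pi> \<mu>) (op_app L (sqrt_density \<pi> \<mu>)))
    \<le> donsker_varadhan \<pi> L \<mu>"
proof -
  define f where "f = sqrt_density \<pi> \<mu>"
  define g where "g = op_app L f"
  \<comment> \<open>A sequence, as dominated convergence is applied along the naturals;
    \<open>Suc\<close> keeps each term positive.\<close>
  define \<epsilon> :: "nat \<Rightarrow> real" where "\<epsilon> n = 1 / Suc n" for n
  define h where "h n x = g x / (f x + \<epsilon> n)" for n x
  have lin: "linear_operator \<pi> L"
    using gen by (simp add: markov_generator_def)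
  have fL2: "f \<in> L2 \<pi>" and gL2: "g \<in> L2 \<pi>"
    using lin f by (auto simp: linear_operator_def f_def g_def)
  have [measurable]: "f \<in> borel_measurable \<pi>" "g \<in> borel_measurable \<pi>"
    using fL2 gL2 by (auto intro: L2_measurable)
  have fg: "integrable \<pi> (\<lambda>x. f x * g x)"
    by (rule L2_integrable_mult[OF fL2 gL2])
  have f_nonneg: "0 \<le> f x" for x
    by (simp add: f_def sqrt_density_def)
  have \<epsilon>_pos: "0 < \<epsilon> n" for n
    by (simp add: \<epsilon>_def)
  have u_pos: "0 < f x + \<epsilon> n" for n x
    using f_nonneg[of x] \<epsilon>_pos[of n] by linarith
  \<comment> \<open>One factor \<open>f x\<close> is absorbed by the denominator, because
    \<open>f x / (f x + \<epsilon> n)\<close> lies between 0 and 1. The bound is uniform in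
    \<open>n\<close>.\<close>
  have bound: "\<bar>(f x)\<^sup>2 * h n x\<bar> \<le> \<bar>f x * g x\<bar>" for n x
  proof -
    have "(f x)\<^sup>2 * h n x = (f x * g x) * (f x / (f x + \<epsilon> n))"
      by (simp add: h_def power2_eq_square)
    moreover have "0 \<le> f x / (f x + \<epsilon> n)" "f x / (f x + \<epsilon> n) \<le> 1"
      using f_nonneg[of x] \<epsilon>_pos[of n] u_pos[of x n] by auto
    ultimately show ?thesis
      using mult_left_le[of "f x / (f x + \<epsilon> n)" "\<bar>f x * g x\<bar>"]
      by (simp only: abs_mult[of "f x * g x"] abs_of_nonneg abs_ge_zero)
  qed
  have [measurable]: "h n \<in> borel_measurable \<pi>" for n
    unfolding h_def by measurable
  have int: "integrable \<pi> (\<lambda>x. (f x)\<^sup>2 * h n x)" for n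
    using bound by (intro Bochner_Integration.integrable_bound[OF fg]) auto
  \<comment> \<open>The infimum is at most its value at the test function
    \<open>f + \<epsilon> n\<close>; the outer minus sign reverses the inequality.\<close>
  have lower: "ereal (- (\<integral>x. (f x)\<^sup>2 * h n x \<partial>\<pi>)) \<le> donsker_varadhan \<pi> L \<mu>" for n
  proof -
    let ?u = "\<lambda>x. f x + \<epsilon> n"
    have u: "?u \<in> op_dom L" "AE x in \<pi>. op_app L ?u x = g x"
      using markov_generator_add_const[OF gen prob(1) f, of "\<epsilon> n"] by (simp_all add: f_def g_def)
    from u(2) have "AE x in \<pi>. op_app L ?u x / ?u x = h n x"
      by eventually_elim (simp add: h_def)
    then have "ext_integral \<mu> (\<lambda>x. op_app L ?u x / ?u x) = ereal (\<integral>x. (f x)\<^sup>2 * h n x \<partial>\<pi>)"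
      using ext_integral_density[OF prob sets ac, of "h n"] int[of n] by (simp add: f_def)
    moreover have "(INF u\<in>{u \<in> op_dom L. AE x in \<pi>. 0 < u x}. ext_integral \<mu> (\<lambda>x. op_app L u x / u x))
      \<le> ext_integral \<mu> (\<lambda>x. op_app L ?u x / ?u x)"
      using u(1) u_pos by (intro INF_lower) simp
    ultimately show ?thesis
      unfolding donsker_varadhan_def uminus_ereal.simps(1)[symmetric] ereal_minus_le_minus by simp
  qed
  \<comment> \<open>Where \<open>f\<close> vanishes, \<open>h n x\<close> may diverge, but the
    factor \<open>(f x)\<^sup>2\<close> keeps the product equal to 0, which is also the
    limit.\<close>
  have pointwise: "(\<lambda>n. (f x)\<^sup>2 * h n x) \<longlonglongrightarrow> f x * g x" for x
  proof (cases "f x = 0")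
    case False
    have "\<epsilon> \<longlonglongrightarrow> 0"
      using LIMSEQ_inverse_real_of_nat by (simp add: \<epsilon>_def[abs_def] inverse_eq_divide)
    then have "(\<lambda>n. (f x)\<^sup>2 * h n x) \<longlonglongrightarrow> (f x)\<^sup>2 * (g x / (f x + 0))"
      unfolding h_def using False by (intro tendsto_intros) auto
    then show ?thesis
      using False by (simp add: power2_eq_square)
  qed simp
  have "(\<lambda>n. \<integral>x. (f x)\<^sup>2 * h n x \<partial>\<pi>) \<longlonglongrightarrow> (\<integral>x. f x * g x \<partial>\<pi>)"
    using pointwise bound
    by (intro integral_dominated_convergence[where w = "\<lambda>x. \<bar>f x * g x\<bar>"]) (auto simp: fg)
  then have "(\<lambda>n. ereal (- (\<integral>x. (f x)\<^sup>2 * h n x \<partial>\<pi>))) \<longlonglongrightarrow> ereal (- (\<integral>x. f x * g x \<partial>\<pi>))"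
    by (intro tendsto_intros)
  then show ?thesis
    using lower by (auto intro!: LIMSEQ_le_const2 simp: L2_inner_def f_def g_def)
qed

theorem lemma3:
  fixes \<pi> \<mu> :: "'a::polish_space measure"
    and L\<^sub>0 S A L :: "'a operator"
    and P\<^sub>0 P\<^sub>S P :: "real \<Rightarrow> 'a \<Rightarrow> 'a measure"
    and M\<^sub>0 :: "'u measure" and X\<^sub>0 :: "real \<Rightarrow> 'u \<Rightarrow> 'a"
    and M\<^sub>S :: "'v measure" and X\<^sub>S :: "real \<Rightarrow> 'v \<Rightarrow> 'a"
    and M :: "'w measure" and X :: "real \<Rightarrow> 'w \<Rightarrow> 'a"
    and I\<^sub>o I\<^sub>S I :: "'a measure \<Rightarrow> ereal"
  assumes "\<pi> \<in> space (prob_algebra borel)"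
    and "reference_process \<pi> P\<^sub>0 L\<^sub>0"
    and "reversible_perturbation \<pi> L\<^sub>0 P\<^sub>S S"
    and "irreversible_perturbation \<pi> L\<^sub>0 S P A"
    and "L = op_add (op_add L\<^sub>0 S) A"
    and "markov_process M\<^sub>0 X\<^sub>0 P\<^sub>0" and "empirical_LDP M\<^sub>0 X\<^sub>0 I\<^sub>o"
    and "DV_rate_function \<pi> L\<^sub>0 I\<^sub>o" and "reversible_rate_function \<pi> L\<^sub>0 I\<^sub>o"
    and "markov_process M\<^sub>S X\<^sub>S P\<^sub>S" and "empirical_LDP M\<^sub>S X\<^sub>S I\<^sub>S"
    and "DV_rate_function \<pi> (op_add L\<^sub>0 S) I\<^sub>S" and "reversible_rate_function \<pi> (op_add L\<^sub>0 S) I\<^sub>S"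
    and "markov_process M X P" and "empirical_LDP M X I"
    and "DV_rate_function \<pi> L I"
    and "\<mu> \<in> space (prob_algebra borel)"
    and "absolutely_continuous \<pi> \<mu>"
    and "sqrt_density \<pi> \<mu> \<in> op_dom L\<^sub>0"
  shows "I \<mu> \<ge> I\<^sub>o \<mu>"
proof -
  define f where "f = sqrt_density \<pi> \<mu>"
  have prob: "prob_space \<pi>" "prob_space \<mu>" and sets: "sets \<mu> = sets \<pi>"
    using assms(1,17) by (auto simp: space_prob_algebra)
  have lin0: "linear_operator \<pi> L\<^sub>0"
    using assms(2) by (simp add: reference_process_def markov_generator_def)
  have S: "linear_operator \<pi> S" "op_dom L\<^sub>0 \<subseteq> op_dom S"
      "\<And>f. f \<in> op_dom S \<Longrightarrow> L2_inner \<pi> f (op_app S f) \<le> 0"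
    using assms(3) by (auto simp: reversible_perturbation_def)
  have A: "linear_operator \<pi> A" "op_dom (op_add L\<^sub>0 S) \<subseteq> op_dom A"
      "\<And>f. f \<in> op_dom A \<Longrightarrow> L2_inner \<pi> f (op_app A f) = - L2_inner \<pi> (op_app A f) f"
    and gen: "markov_generator \<pi> P L"
    using assms(4,5) by (auto simp: irreversible_perturbation_def)
  have f0: "f \<in> op_dom L\<^sub>0"
    using assms(19) by (simp add: f_def)
  \<comment> \<open>The domain of a sum is the intersection of the domains, so the two inclusions
    must be used in turn: first \<open>S\<close>, then \<open>A\<close>.\<close>
  have fS: "f \<in> op_dom S" and fA: "f \<in> op_dom A"
    using f0 S(2) A(2) by (auto simp: op_add_def)
  have fL: "f \<in> op_dom L"
    using f0 fS fA by (simp add: assms(5) op_add_def)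
  have L2: "f \<in> L2 \<pi>" "op_app L\<^sub>0 f \<in> L2 \<pi>" "op_app S f \<in> L2 \<pi>" "op_app A f \<in> L2 \<pi>"
    using lin0 S(1) A(1) f0 fS fA by (auto simp: linear_operator_def)
  note int = L2_integrable_mult[OF L2(1,2)] L2_integrable_mult[OF L2(1,3)]
    L2_integrable_mult[OF L2(1,4)]
  \<comment> \<open>With both arguments equal to \<open>f\<close>, symmetry of the real scalar
    product turns antisymmetry into a = -a.\<close>
  have A0: "L2_inner \<pi> f (op_app A f) = 0"
    using A(3)[OF fA] by (simp add: L2_inner_def mult.commute)
  have "L2_inner \<pi> f (op_app L f)
      = L2_inner \<pi> f (op_app L\<^sub>0 f) + L2_inner \<pi> f (op_app S f) + L2_inner \<pi> f (op_app A f)"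
    using int by (simp add: assms(5) op_add_def L2_inner_def distrib_left)
  \<comment> \<open>The difference of the two sides is the Dirichlet form of \<open>S\<close> at
    \<open>f\<close>, which is nonnegative.\<close>
  then have "L2_inner \<pi> f (\<lambda>x. - op_app L\<^sub>0 f x) \<le> - L2_inner \<pi> f (op_app L f)"
    using A0 S(3)[OF fS] by (simp add: L2_inner_def)
  moreover have "I\<^sub>o \<mu> = ereal (L2_inner \<pi> f (\<lambda>x. - op_app L\<^sub>0 f x))"
    using assms(9,17-19) by (simp add: reversible_rate_function_def f_def)
  moreover have "ereal (- L2_inner \<pi> f (op_app L f)) \<le> donsker_varadhan \<pi> L \<mu>"
    using donsker_varadhan_ge[OF gen prob sets assms(18)] fL by (simp add: f_def)
  moreover have "I \<mu> = donsker_varadhan \<pi> L \<mu>"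
    using assms(16-18) by (simp add: DV_rate_function_def)
  ultimately show ?thesis
    using order_trans[of "ereal (L2_inner \<pi> f (\<lambda>x. - op_app L\<^sub>0 f x))"
        "ereal (- L2_inner \<pi> f (op_app L f))" "I \<mu>"] by simp
qed

end
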